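(* Let $k$ be a finite field of characteristic two and $(V,q)$ a quadratic space over $k$ with $\dim_k V=2n$ and $n\ge4$. Then the exact sequences $0\to\widehat V\to\mathrm{APs}_k(V)\to\mathrm{Sp}_k(V,\omega_q)\to1$, $0\to\widehat V\to\mathrm{Ps}_k(V,q)\to O_k(V,q)\to1$, $0\to\widehat V\to\widehat V\#_\theta\Omega_k(V,q)\to\Omega_k(V,q)\to1$ do not split.
   Context: $V$ is a finite-dimensional $k$-vector space with a quadratic form $q:V\to k$ whose polar form $B_q(v,w)=q(v+w)-q(v)-q(w)$ is non-degenerate. Let $\mathrm{Tr}:k\to\mathbb F_2$ be the absolute trace, $\omega_q(v,w)=(-1)^{\mathrm{Tr}(B_q(v,w))}$, and $\widehat V=\mathrm{Hom}(V,\mathbb C^* )$ the character group of the additive group $V$. $\mathrm{Sp}_k(V,\omega_q)=\mathrm{Sp}_k(V)$ is the group of $k$-linear automorphisms preserving $B_q$, $O_k(V,q)\le\mathrm{Sp}_k(V)$ those preserving $q$, and $\Omega_k(V,q)$ the index-$2$ subgroup of $O_k(V,q)$ of elements with Dickson invariant zero. Fix a normalized 2-cocycle $\alpha:V\times V\to\mathbb C^*$ with $\alpha(v,w)/\alpha(w,v)=\omega_q(v,w)$ and let $\mathbb C_\alpha[V]$ be the twisted group algebra (basis $u_v$, $u_vu_w=\alpha(v,w)u_{v+w}$). $\mathrm{APs}_k(V)$ (the linear affine pseudo-symplectic group, a crossed product $\widehat V\#_\theta\mathrm{Sp}_k(V)$) is the group under composition of all $\mathbb C$-algebra automorphisms $\varphi$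 of $\mathbb C_\alpha[V]$ for which there is $g\in\mathrm{Sp}_k(V)$ with $\varphi(u_v)\in\mathbb C^*u_{g(v)}$ for all $v\in V$; the map $\varphi\mapsto g$ is a surjection onto $\mathrm{Sp}_k(V)$ whose kernel is the group of automorphisms $u_v\mapsto\chi(v)u_v$, $\chi\in\widehat V$, identified with $\widehat V$. $\mathrm{Ps}_k(V,q)$ (the linear pseudo-symplectic group $\widehat V\#_\theta O_k(V,q)$) is the preimage of $O_k(V,q)$ in $\mathrm{APs}_k(V)$, and $\widehat V\#_\theta\Omega_k(V,q)$ is the preimage of $\Omega_k(V,q)$. The maps in the sequences are these inclusions and projections. *)

theory Defs
  imports "HOL-Analysis.Analysis"
begin

text \<open>Vector space V = k^I (type 'k ^ 'i), quadratic forms, symplectic / orthogonal groups.\<close>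

definition polar :: "('k::field ^ 'i \<Rightarrow> 'k) \<Rightarrow> 'k ^ 'i \<Rightarrow> 'k ^ 'i \<Rightarrow> 'k" where
  "polar q v w = q (v + w) - q v - q w"

definition is_quadratic_form :: "('k::field ^ 'i::finite \<Rightarrow> 'k) \<Rightarrow> bool" where
  "is_quadratic_form q \<longleftrightarrow>
     (\<forall>c v. q (c *s v) = c^2 * q v) \<and>
     (\<forall>v. Vector_Spaces.linear (*s) (*) (\<lambda>w. polar q v w)) \<and>
     (\<forall>w. Vector_Spaces.linear (*s) (*) (\<lambda>v. polar q v w))"

definition nondegenerate_polar :: "('k::field ^ 'i::finite \<Rightarrow> 'k) \<Rightarrow> bool" where
  "nondegenerate_polar q \<longleftrightarrow> (\<forall>v. (\<forall>w. polar q v w = 0) \<longrightarrow> v = 0)"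

text \<open>Absolute trace k \<rightarrow> F_2 for a finite field of order 2^m: x + x^2 + ... + x^(2^(m-1)).
  Its value lies in the prime field {0,1}.\<close>
definition abs_trace :: "'k::{field,finite} \<Rightarrow> 'k" where
  "abs_trace x = (\<Sum>i < (THE m. CARD('k) = 2 ^ m). x ^ (2 ^ i))"

definition omega_q :: "('k::{field,finite} ^ 'i::finite \<Rightarrow> 'k) \<Rightarrow> 'k ^ 'i \<Rightarrow> 'k ^ 'i \<Rightarrow> complex" where
  "omega_q q v w = (if abs_trace (polar q v w) = 0 then 1 else -1)"

definition Sp_group :: "('k::field ^ 'i::finite \<Rightarrow> 'k) \<Rightarrow> ('k ^ 'i \<Rightarrow> 'k ^ 'i) set" where
  "Sp_group q = {g. Vector_Spaces.linear (*s) (*s) g \<and> bij g \<and>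
                    (\<forall>v w. polar q (g v) (g w) = polar q v w)}"

definition O_group :: "('k::field ^ 'i::finite \<Rightarrow> 'k) \<Rightarrow> ('k ^ 'i \<Rightarrow> 'k ^ 'i) set" where
  "O_group q = {g \<in> Sp_group q. \<forall>v. q (g v) = q v}"

text \<open>Dickson invariant (characteristic 2): rank of (g - id) modulo 2.\<close>
definition dickson_invariant :: "('k::field ^ 'i::finite \<Rightarrow> 'k ^ 'i) \<Rightarrow> nat" where
  "dickson_invariant g = vec.dim (range (\<lambda>v. g v - v)) mod 2"

definition Omega_group :: "('k::field ^ 'i::finite \<Rightarrow> 'k) \<Rightarrow> ('k ^ 'i \<Rightarrow> 'k ^ 'i) set" where
  "Omega_group q = {g \<in> O_group q. dickson_invariant g = 0}"

text \<open>Twisted group algebra C_alpha[V]: functions V \<Rightarrow> complex (V finite), basis u_v.\<close>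

definition normalized_2cocycle :: "('v::ab_group_add \<Rightarrow> 'v \<Rightarrow> complex) \<Rightarrow> bool" where
  "normalized_2cocycle \<alpha> \<longleftrightarrow>
     (\<forall>v w. \<alpha> v w \<noteq> 0) \<and> (\<forall>v. \<alpha> 0 v = 1 \<and> \<alpha> v 0 = 1) \<and>
     (\<forall>u v w. \<alpha> u v * \<alpha> (u + v) w = \<alpha> v w * \<alpha> u (v + w))"

definition tw_basis :: "'v \<Rightarrow> ('v \<Rightarrow> complex)" where
  "tw_basis v = (\<lambda>w. if w = v then 1 else 0)"

definition tw_mult :: "('v::{ab_group_add,finite} \<Rightarrow> 'v \<Rightarrow> complex) \<Rightarrow>
     ('v \<Rightarrow> complex) \<Rightarrow> ('v \<Rightarrow> complex) \<Rightarrow> ('v \<Rightarrow> complex)" where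
  "tw_mult \<alpha> f g = (\<lambda>z. \<Sum>v\<in>UNIV. \<alpha> v (z - v) * f v * g (z - v))"

definition tw_algebra_aut :: "('v::{ab_group_add,finite} \<Rightarrow> 'v \<Rightarrow> complex) \<Rightarrow>
     (('v \<Rightarrow> complex) \<Rightarrow> ('v \<Rightarrow> complex)) \<Rightarrow> bool" where
  "tw_algebra_aut \<alpha> \<phi> \<longleftrightarrow> bij \<phi> \<and>
     (\<forall>f g. \<phi> (\<lambda>x. f x + g x) = (\<lambda>x. \<phi> f x + \<phi> g x)) \<and>
     (\<forall>c f. \<phi> (\<lambda>x. c * f x) = (\<lambda>x. c * \<phi> f x)) \<and>
     (\<forall>f g. \<phi> (tw_mult \<alpha> f g) = tw_mult \<alpha> (\<phi> f) (\<phi> g)) \<and>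
     \<phi> (tw_basis 0) = tw_basis 0"

text \<open>phi lies over g: phi(u_v) \<in> C^* u_{g v} for all v.\<close>
definition lies_over :: "(('v \<Rightarrow> complex) \<Rightarrow> ('v \<Rightarrow> complex)) \<Rightarrow> ('v \<Rightarrow> 'v) \<Rightarrow> bool" where
  "lies_over \<phi> g \<longleftrightarrow> (\<forall>v. \<exists>c. c \<noteq> 0 \<and> \<phi> (tw_basis v) = (\<lambda>x. c * tw_basis (g v) x))"

definition APs :: "('k::{field,finite} ^ 'i::finite \<Rightarrow> 'k) \<Rightarrow> ('k ^ 'i \<Rightarrow> 'k ^ 'i \<Rightarrow> complex) \<Rightarrow>
     ((('k ^ 'i) \<Rightarrow> complex) \<Rightarrow> (('k ^ 'i) \<Rightarrow> complex)) set" where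
  "APs q \<alpha> = {\<phi>. tw_algebra_aut \<alpha> \<phi> \<and> (\<exists>g \<in> Sp_group q. lies_over \<phi> g)}"

text \<open>The extension  0 \<rightarrow> V^ \<rightarrow> (preimage of G in APs) \<rightarrow> G \<rightarrow> 1  splits iff there is a group
  homomorphism section s : G \<rightarrow> APs with projection(s g) = g.\<close>
definition ext_splits :: "('k::{field,finite} ^ 'i::finite \<Rightarrow> 'k) \<Rightarrow> ('k ^ 'i \<Rightarrow> 'k ^ 'i \<Rightarrow> complex) \<Rightarrow>
     ('k ^ 'i \<Rightarrow> 'k ^ 'i) set \<Rightarrow> bool" where
  "ext_splits q \<alpha> G \<longleftrightarrow> (\<exists>s. (\<forall>g\<in>G. s g \<in> APs q \<alpha> \<and> lies_over (s g) g) \<and>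
                              (\<forall>g\<in>G. \<forall>h\<in>G. s (g \<circ> h) = s g \<circ> s h))"

end

theory Submission
  imports Defs "HOL-Computational_Algebra.Polynomial"
begin

text \<open>Suppose the extension over \<open>\<Omega>\<close> splits by a section \<open>s\<close>. If \<open>g \<in> \<Omega>\<close> is an involution and
  \<open>g z = z + p\<close>, then \<open>s g\<close> is an involutive automorphism of \<open>\<complex>\<^sub>\<alpha>[V]\<close> lying over \<open>g\<close>; applying it to the
  relations \<open>u\<^sub>z u\<^sub>z = \<alpha>(z,z)\<close> and \<open>u\<^sub>z u\<^sub>p = \<alpha>(z,p) u\<^sub>z\<^sub>+\<^sub>p\<close> forces \<open>s g (u\<^sub>p) = \<omega>\<^sub>q(z,p) u\<^sub>p\<close>, and
  \<open>\<omega>\<^sub>q(z,p) = (-1)\<^bsup>Tr q(p)\<^esup>\<close> because \<open>g\<close> preserves \<open>q\<close>. Inside four hyperbolic pairs \<open>(w\<^sub>i, y\<^sub>i)\<close> with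
  \<open>q(w\<^sub>i) = 1\<close> one writes down involutions \<open>X, Y\<close> and \<open>XY\<close> in \<open>\<Omega>\<close>, each moving some vector by
  \<open>p = t w\<^sub>0\<close> where \<open>Tr(t\<^sup>2) \<noteq> 0\<close>. Then \<open>s(XY)\<close> negates \<open>u\<^sub>p\<close>, while \<open>s X \<circ> s Y\<close> fixes it.
  Since \<open>\<Omega> \<subseteq> O \<subseteq> Sp\<close>, a splitting over \<open>O\<close> or \<open>Sp\<close> would restrict to one over \<open>\<Omega>\<close>.\<close>

section \<open>Fields of characteristic two\<close>

lemma char2_add_self:
  assumes "CHAR('a::ring_1) = 2" shows "(x::'a) + x = 0"
  by (metis assms uminus_CHAR_2 add.right_inverse)

lemma char2_numeral_Bit0:
  assumes "CHAR('a::ring_1) = 2" shows "(numeral (Num.Bit0 n) :: 'a) = 0"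
  by (metis assms char2_add_self numeral_Bit0)

lemma char2_numeral_Bit1:
  assumes "CHAR('a::ring_1) = 2" shows "(numeral (Num.Bit1 n) :: 'a) = 1"
  by (metis assms char2_add_self numeral_Bit1 add_0)

lemma card_union_translate_closed:
  fixes S :: "'a::{ab_group_add,finite} set"
  assumes self: "\<And>x::'a. x + x = 0" and closed: "\<forall>x\<in>S. \<forall>y\<in>S. x + y \<in> S" and "a \<notin> S"
  defines "T \<equiv> S \<union> (+) a ` S"
  shows "\<forall>x\<in>T. \<forall>y\<in>T. x + y \<in> T" and "card T = 2 * card S"
proof -
  have cancel: "a + (a + z) = z" for z
    by (metis self add.assoc add_0)
  have mem_T: "z \<in> T \<longleftrightarrow> z \<in> S \<or> a + z \<in> S" for z
    unfolding T_def by (metis cancel Un_iff image_iff)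
  show "\<forall>x\<in>T. \<forall>y\<in>T. x + y \<in> T"
  proof (intro ballI)
    fix x y assume "x \<in> T" "y \<in> T"
    have "a + (x + y) = (a + x) + y" "a + (x + y) = x + (a + y)" "x + y = (a + x) + (a + y)"
      by (simp_all add: algebra_simps cancel)
    then show "x + y \<in> T"
      using \<open>x \<in> T\<close> \<open>y \<in> T\<close> closed unfolding mem_T by metis
  qed
  have "S \<inter> (+) a ` S = {}"
  proof (rule ccontr)
    assume "S \<inter> (+) a ` S \<noteq> {}"
    then obtain s where "s \<in> S" "a + s \<in> S" using cancel by auto
    moreover have "a = (a + s) + s" by (metis self add.assoc add_0_right)
    ultimately show False using closed \<open>a \<notin> S\<close> by metis
  qed
  then show "card T = 2 * card S"
    unfolding T_def by (subst card_Un_disjoint) (auto simp: card_image)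
qed

lemma card_elementary_2group:
  assumes self: "\<And>x::'a::{ab_group_add,finite}. x + x = 0"
  shows "\<exists>m. CARD('a) = 2 ^ m"
proof -
  have "\<exists>m. CARD('a) = card S * 2 ^ m"
    if "0 \<in> S" "\<forall>x\<in>S. \<forall>y\<in>S. x + y \<in> S" for S :: "'a set"
    using that
  proof (induction "card (UNIV - S)" arbitrary: S rule: less_induct)
    case less
    show ?case
    proof (cases "S = UNIV")
      case False
      then obtain a where a: "a \<notin> S" by auto
      define T where "T = S \<union> (+) a ` S"
      note T = card_union_translate_closed[OF self less.prems(2) a, folded T_def]
      have "a \<in> T" "0 \<in> T"
        unfolding T_def using less.prems(1) image_eqI[of a "(+) a" 0] by auto
      then have "card (UNIV - T) < card (UNIV - S)"
        using a unfolding T_def by (intro psubset_card_mono) auto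
      then obtain m where "CARD('a) = card T * 2 ^ m"
        using less.hyps \<open>0 \<in> T\<close> T(1) by blast
      then show ?thesis using T(2) by (intro exI[of _ "Suc m"]) simp
    qed (intro exI[of _ 0], simp)
  qed
  from this[of "{0}"] show ?thesis by simp
qed

lemma card_char2_field:
  assumes "CHAR('k::{field,finite}) = 2" shows "\<exists>m. CARD('k) = 2 ^ m"
  using card_elementary_2group char2_add_self[OF assms] by blast

lemma exists_abs_trace_nonzero:
  assumes char2: "CHAR('k::{field,finite}) = 2"
  shows "\<exists>s::'k. abs_trace s \<noteq> 0"
proof -
  obtain m where m: "CARD('k) = 2 ^ m" using card_char2_field[OF char2] by blast
  have the_m: "(THE m. CARD('k) = 2 ^ m) = m"
    by (rule the_equality) (use m in auto)
  have "card {0::'k, 1} \<le> CARD('k)" by (intro card_mono) auto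
  then have m1: "m \<ge> 1" using m by (cases m) auto
  text \<open>The trace is a polynomial function of degree \<open>2^(m-1) < |k|\<close>, so it has a non-root.\<close>
  define P :: "'k poly" where "P = (\<Sum>i<m. monom 1 (2 ^ i))"
  have poly_P: "poly P x = abs_trace x" for x
    unfolding P_def abs_trace_def the_m by (simp add: poly_sum poly_monom)
  have "coeff P (2 ^ (m - 1)) = (\<Sum>i<m. if 2 ^ i = (2::nat) ^ (m - 1) then 1 else 0)"
    unfolding P_def by (simp add: coeff_sum)
  also have "\<dots> = (\<Sum>i\<in>{m - 1}. 1)"
    by (rule sum.mono_neutral_cong_right) (use m1 in auto)
  finally have "P \<noteq> 0" by auto
  have "degree P \<le> 2 ^ (m - 1)"
    unfolding P_def
  proof (rule degree_sum_le)
    fix i assume "i \<in> {..<m}"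
    then have "(2::nat) ^ i \<le> 2 ^ (m - 1)" by (intro power_increasing) auto
    then show "degree (monom (1::'k) (2 ^ i)) \<le> 2 ^ (m - 1)" by (simp add: degree_monom_eq)
  qed simp
  moreover have "(2::nat) ^ (m - 1) < 2 ^ m" using m1 by (intro power_strict_increasing) auto
  ultimately have "card {x. poly P x = 0} < CARD('k)"
    using card_poly_roots_bound[OF \<open>P \<noteq> 0\<close>] m by linarith
  then have "{x. poly P x = 0} \<noteq> UNIV" by auto
  then show ?thesis using poly_P by auto
qed

lemma char2_square_surj:
  assumes char2: "CHAR('k::{field,finite}) = 2"
  shows "surj (\<lambda>r::'k. r ^ 2)"
proof -
  have "inj (\<lambda>r::'k. r ^ 2)"
  proof (rule injI)
    fix x y :: 'k assume "x ^ 2 = y ^ 2"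
    have "(x + y) ^ 2 = x ^ 2 + y ^ 2"
      by (rule freshmans_dream) (use char2 in auto)
    then have "(x + y) ^ 2 = 0" using \<open>x ^ 2 = y ^ 2\<close> char2_add_self[OF char2] by simp
    then show "x = y" by (metis char2 minus_CHAR_2 right_minus_eq zero_eq_power2)
  qed
  then show ?thesis by (simp add: finite_UNIV_inj_surj)
qed

section \<open>The twisted group algebra\<close>

abbreviation cmult :: "complex \<Rightarrow> ('v \<Rightarrow> complex) \<Rightarrow> ('v \<Rightarrow> complex)" where
  "cmult c f \<equiv> (\<lambda>x. c * f x)"

lemma tw_mult_basis:
  fixes \<alpha> :: "'v::{ab_group_add,finite} \<Rightarrow> 'v \<Rightarrow> complex"
  shows "tw_mult \<alpha> (tw_basis a) (tw_basis b) = cmult (\<alpha> a b) (tw_basis (a + b))"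
proof
  fix z
  have "tw_mult \<alpha> (tw_basis a) (tw_basis b) z
      = (\<Sum>v\<in>UNIV. if v = a then \<alpha> a (z - a) * tw_basis b (z - a) else 0)"
    unfolding tw_mult_def by (intro sum.cong) (auto simp: tw_basis_def)
  also have "\<dots> = \<alpha> a b * tw_basis (a + b) z"
    by (auto simp: tw_basis_def algebra_simps)
  finally show "tw_mult \<alpha> (tw_basis a) (tw_basis b) z = \<alpha> a b * tw_basis (a + b) z" .
qed

lemma tw_mult_cmult: "tw_mult \<alpha> (cmult c f) (cmult d g) = cmult (c * d) (tw_mult \<alpha> f g)"
  unfolding tw_mult_def by (auto simp: sum_distrib_left algebra_simps)

lemma cmult_tw_basis_eq_iff: "cmult c (tw_basis a) = cmult d (tw_basis a) \<longleftrightarrow> c = d"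
  by (metis tw_basis_def mult.right_neutral)

lemma tw_algebra_aut_cmult: "tw_algebra_aut \<alpha> \<phi> \<Longrightarrow> \<phi> (cmult c f) = cmult c (\<phi> f)"
  unfolding tw_algebra_aut_def by blast

lemma tw_algebra_aut_one: "tw_algebra_aut \<alpha> \<phi> \<Longrightarrow> \<phi> (tw_basis 0) = tw_basis 0"
  unfolding tw_algebra_aut_def by blast

lemma tw_algebra_aut_basis_mult:
  fixes \<alpha> :: "'v::{ab_group_add,finite} \<Rightarrow> 'v \<Rightarrow> complex"
  assumes "tw_algebra_aut \<alpha> \<phi>"
    and "\<phi> (tw_basis a) = cmult c (tw_basis a')" and "\<phi> (tw_basis b) = cmult d (tw_basis b')"
  shows "\<phi> (cmult (\<alpha> a b) (tw_basis (a + b))) = cmult (c * d * \<alpha> a' b') (tw_basis (a' + b'))"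
proof -
  have "\<phi> (cmult (\<alpha> a b) (tw_basis (a + b))) = tw_mult \<alpha> (\<phi> (tw_basis a)) (\<phi> (tw_basis b))"
    using assms(1) unfolding tw_algebra_aut_def by (simp flip: tw_mult_basis)
  also have "\<dots> = cmult (c * d) (cmult (\<alpha> a' b') (tw_basis (a' + b')))"
    unfolding assms(2,3) tw_mult_cmult tw_mult_basis ..
  finally show ?thesis by (simp add: mult.assoc)
qed

text \<open>Compare the images of the relations \<open>u\<^sub>w u\<^sub>w = \<alpha>(w,w)\<close> and \<open>u\<^sub>w u\<^sub>p = \<alpha>(w,p) u\<^sub>w\<^sub>+\<^sub>p\<close>, then use
  the cocycle identity.\<close>
lemma involutive_lift_basis:
  fixes \<alpha> :: "'v::{ab_group_add,finite} \<Rightarrow> 'v \<Rightarrow> complex"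
  assumes self: "\<And>v::'v. v + v = 0" and cocycle: "normalized_2cocycle \<alpha>"
    and aut: "tw_algebra_aut \<alpha> \<phi>" and over: "lies_over \<phi> h" and invol: "\<And>f. \<phi> (\<phi> f) = f"
    and hp: "h p = p" and hw: "h w = w + p" and hwp: "h (w + p) = w"
  shows "\<phi> (tw_basis p) = cmult (\<alpha> w p / \<alpha> p w) (tw_basis p)"
proof -
  have nz: "\<alpha> a b \<noteq> 0" and a0: "\<alpha> 0 a = 1" "\<alpha> a 0 = 1"
    and C: "\<alpha> a b * \<alpha> (a + b) x = \<alpha> b x * \<alpha> a (b + x)" for a b x
    using cocycle unfolding normalized_2cocycle_def by blast+
  obtain c0 where c0: "\<phi> (tw_basis p) = cmult c0 (tw_basis p)"
    using over hp unfolding lies_over_def by metis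
  obtain c where c: "\<phi> (tw_basis w) = cmult c (tw_basis (w + p))"
    using over hw unfolding lies_over_def by metis
  obtain c' where c': "\<phi> (tw_basis (w + p)) = cmult c' (tw_basis w)"
    using over hwp unfolding lies_over_def by metis
  have wp: "w + p + (w + p) = 0" "w + p + p = w" "w + w = 0"
    by (simp_all add: self)
  have "cmult (\<alpha> w w) (tw_basis 0) = \<phi> (cmult (\<alpha> w w) (tw_basis (w + w)))"
    using wp(3) tw_algebra_aut_cmult[OF aut] tw_algebra_aut_one[OF aut] by simp
  also have "\<dots> = cmult (c * c * \<alpha> (w + p) (w + p)) (tw_basis 0)"
    using tw_algebra_aut_basis_mult[OF aut c c] wp(1) by simp
  finally have E1: "\<alpha> w w = c * c * \<alpha> (w + p) (w + p)"
    by (simp only: cmult_tw_basis_eq_iff)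
  have "cmult (c * c0 * \<alpha> (w + p) p) (tw_basis w) = cmult (\<alpha> w p * c') (tw_basis w)"
    using tw_algebra_aut_basis_mult[OF aut c c0] wp
      tw_algebra_aut_cmult[OF aut] c' by (simp add: mult.assoc)
  then have E2: "c * c0 * \<alpha> (w + p) p = \<alpha> w p * c'"
    by (simp only: cmult_tw_basis_eq_iff)
  have "cmult 1 (tw_basis w) = cmult (c * c') (tw_basis w)"
    using invol[of "tw_basis w"] c c' tw_algebra_aut_cmult[OF aut] by (simp add: mult.assoc)
  then have E3: "c * c' = 1"
    by (simp only: cmult_tw_basis_eq_iff)
  have C1: "\<alpha> w p * \<alpha> (w + p) p = \<alpha> p p"
    using C[of w p p] by (simp add: self a0)
  have C2: "\<alpha> w p * \<alpha> (w + p) (w + p) = \<alpha> p (w + p) * \<alpha> w w"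
    using C[of w p "w + p"] by (metis add.left_commute add_0_right self)
  have C3: "\<alpha> p p = \<alpha> p w * \<alpha> p (p + w)"
    using C[of p p w] by (simp add: self a0)
  have "\<alpha> w p = c * c * c0 * \<alpha> (w + p) p"
    using E2 E3 by (metis mult.assoc mult.commute mult.right_neutral)
  then have "\<alpha> p (w + p) = c0 * \<alpha> (w + p) p"
    using C2 E1 nz[of w w] by (simp add: mult.commute mult.left_commute)
  then have "\<alpha> w p = \<alpha> p w * c0"
    using C1 C3 nz[of "w + p" p] by (simp add: add.commute)
  then show ?thesis
    using c0 nz[of p w] by (simp add: field_simps)
qed

section \<open>Splittings\<close>

lemma ext_splits_mono: "ext_splits q \<alpha> G \<Longrightarrow> H \<subseteq> G \<Longrightarrow> ext_splits q \<alpha> H"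
  unfolding ext_splits_def by (metis subsetD)

lemma id_in_Omega_group: "id \<in> Omega_group (q :: 'k::field ^ 'i::finite \<Rightarrow> 'k)"
proof -
  have "range (\<lambda>v::'k ^ 'i. id v - v) = {0}" by auto
  moreover have "vec.dim {0::'k ^ 'i} = 0"
    using vec.dim_le_card[of "{0::'k ^ 'i}" "{}"] by simp
  ultimately have "dickson_invariant (id :: 'k ^ 'i \<Rightarrow> 'k ^ 'i) = 0"
    unfolding dickson_invariant_def by simp
  then show ?thesis
    unfolding Omega_group_def O_group_def Sp_group_def using vec.linear_id by auto
qed

lemma ext_split_section_involutive:
  assumes lifts: "\<forall>g\<in>G. s g \<in> APs q \<alpha> \<and> lies_over (s g) g"
    and hom: "\<forall>g\<in>G. \<forall>h\<in>G. s (g \<circ> h) = s g \<circ> s h"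
    and "id \<in> G" "g \<in> G" "g \<circ> g = id"
  shows "s g (s g f) = f"
proof -
  have "inj (s id)"
    using lifts \<open>id \<in> G\<close> unfolding APs_def tw_algebra_aut_def bij_def by blast
  moreover have "s id (s id f) = s id f" for f
    using hom \<open>id \<in> G\<close> by (metis comp_apply id_comp)
  ultimately have "s id f = f" for f by (meson injD)
  then show ?thesis
    using hom \<open>g \<in> G\<close> \<open>g \<circ> g = id\<close> by (metis comp_apply)
qed

section \<open>Quadratic spaces in characteristic two\<close>

locale char2_quadratic_space =
  fixes q :: "'k::{field,finite} ^ 'i::finite \<Rightarrow> 'k"
  assumes char2: "CHAR('k) = 2" and quadratic: "is_quadratic_form q"
    and nondegenerate: "nondegenerate_polar q"
begin

abbreviation B where "B \<equiv> polar q"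

lemma add_self [simp]: "(x::'k) + x = 0"
  using char2_add_self[OF char2] .

lemma numeral_Bit0 [simp]: "(numeral (Num.Bit0 n) :: 'k) = 0"
  using char2_numeral_Bit0[OF char2] .

lemma numeral_Bit1 [simp]: "(numeral (Num.Bit1 n) :: 'k) = 1"
  using char2_numeral_Bit1[OF char2] .

lemma vec_add_self [simp]: "(v::'k ^ 'i) + v = 0"
  by (simp add: vec_eq_iff)

lemma vec_minus [simp]: "- (v::'k ^ 'i) = v"
  by (metis add_eq_0_iff vec_add_self)

lemma vec_diff_eq_add [simp]: "(v::'k ^ 'i) - w = v + w"
  by (metis diff_conv_add_uminus vec_minus)

lemma q_scale: "q (c *s v) = c ^ 2 * q v"
  using quadratic unfolding is_quadratic_form_def by blast

lemma q_zero [simp]: "q 0 = 0"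
  using q_scale[of 0 0] by simp

lemma B_add_left: "B (a + b) w = B a w + B b w"
  and B_scale_left: "B (c *s a) w = c * B a w"
  using quadratic unfolding is_quadratic_form_def Vector_Spaces.linear_iff by blast+

lemma B_add_right: "B v (a + b) = B v a + B v b"
  and B_scale_right: "B v (c *s a) = c * B v a"
  using quadratic unfolding is_quadratic_form_def Vector_Spaces.linear_iff by blast+

lemma B_sym: "B v w = B w v"
  unfolding polar_def by (simp add: add.commute)

lemma B_self [simp]: "B v v = 0"
  unfolding polar_def by simp

lemma B_zero_left [simp]: "B 0 w = 0"
  using B_scale_left[of 0 0 w] by simp

lemma B_sum_left: "B (\<Sum>a\<in>S. f a) x = (\<Sum>a\<in>S. B (f a) x)"
  by (induct S rule: infinite_finite_induct) (auto simp: B_add_left)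

lemma q_add: "q (v + w) = q v + q w + B v w"
  unfolding polar_def by simp

lemma B_nonzero_partner: "v \<noteq> 0 \<Longrightarrow> \<exists>z. B v z \<noteq> 0"
  using nondegenerate unfolding nondegenerate_polar_def by blast

lemma B_eq_if_preserves_q:
  assumes "\<And>z. q (g z) = q z" and "\<And>a b. g (a + b) = g a + g b"
  shows "B (g v) (g u) = B v u"
  unfolding polar_def using assms by metis

lemma orthogonal_involution_moves:
  assumes "g \<in> O_group q" "g \<circ> g = id" "g z = z + p"
  shows "g p = p" "g (z + p) = z" "B z p = q p"
proof -
  have add: "g (a + b) = g a + g b" for a b
    using assms(1) unfolding O_group_def Sp_group_def Vector_Spaces.linear_iff by blast
  show gzp: "g (z + p) = z"
    using assms(2,3) by (metis comp_apply id_apply)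
  then show "g p = p"
    using add assms(3) by (metis add.assoc add_left_cancel vec_add_self add_0_right)
  have "q (z + p) = q z"
    using assms(1) gzp unfolding O_group_def by (metis (mono_tags, lifting) mem_Collect_eq)
  then show "B z p = q p"
    unfolding q_add by (metis add.assoc add_self add_0_right add_left_cancel)
qed

text \<open>As \<open>g\<close> preserves \<open>q\<close>, \<open>B z p = q p\<close>; so the factor \<open>\<omega>\<^sub>q(z,p)\<close> by which the lift acts on \<open>u\<^sub>p\<close>
  is \<open>(-1)\<^bsup>Tr q(p)\<^esup>\<close>.\<close>
lemma involutive_lift_orthogonal_involution:
  fixes \<alpha> :: "'k ^ 'i \<Rightarrow> 'k ^ 'i \<Rightarrow> complex"
  assumes cocycle: "normalized_2cocycle \<alpha>" and omega: "\<forall>v w. \<alpha> v w / \<alpha> w v = omega_q q v w"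
    and aut: "tw_algebra_aut \<alpha> \<phi>" and over: "lies_over \<phi> g" and invol: "\<And>f. \<phi> (\<phi> f) = f"
    and g: "g \<in> O_group q" "g \<circ> g = id" "g z = z + p" and trace: "abs_trace (q p) \<noteq> 0"
  shows "\<phi> (tw_basis p) = cmult (-1) (tw_basis p)"
proof -
  note moves = orthogonal_involution_moves[OF g]
  have "\<phi> (tw_basis p) = cmult (\<alpha> z p / \<alpha> p z) (tw_basis p)"
    using involutive_lift_basis[OF vec_add_self cocycle aut over invol moves(1) g(3) moves(2)] .
  also have "\<alpha> z p / \<alpha> p z = -1"
    using omega trace moves(3) unfolding omega_q_def by simp
  finally show ?thesis .
qed

subsection \<open>Hyperbolic families\<close>

definition hyperbolic_family :: "nat \<Rightarrow> (nat \<Rightarrow> 'k ^ 'i) \<Rightarrow> (nat \<Rightarrow> 'k ^ 'i) \<Rightarrow> bool" where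
  "hyperbolic_family j w y \<longleftrightarrow> (\<forall>a<j. \<forall>b<j. B (w a) (w b) = 0 \<and> B (y a) (y b) = 0 \<and>
     B (w a) (y b) = (if a = b then 1 else 0))"

definition perp :: "nat \<Rightarrow> (nat \<Rightarrow> 'k ^ 'i) \<Rightarrow> (nat \<Rightarrow> 'k ^ 'i) \<Rightarrow> ('k ^ 'i) set" where
  "perp j w y = {u. \<forall>a<j. B u (w a) = 0 \<and> B u (y a) = 0}"

definition perp_proj :: "nat \<Rightarrow> (nat \<Rightarrow> 'k ^ 'i) \<Rightarrow> (nat \<Rightarrow> 'k ^ 'i) \<Rightarrow> 'k ^ 'i \<Rightarrow> 'k ^ 'i" where
  "perp_proj j w y z = z + (\<Sum>a<j. B z (y a) *s w a + B z (w a) *s y a)"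

lemma perp_add: "u \<in> perp j w y \<Longrightarrow> v \<in> perp j w y \<Longrightarrow> u + v \<in> perp j w y"
  unfolding perp_def by (simp add: B_add_left)

lemma perp_scale: "u \<in> perp j w y \<Longrightarrow> c *s u \<in> perp j w y"
  unfolding perp_def by (simp add: B_scale_left)

lemma perp_proj_in_perp:
  assumes "hyperbolic_family j w y"
  shows "perp_proj j w y z \<in> perp j w y"
proof -
  have delta: "(\<Sum>a<j. f a * (if a = b then 1 else 0)) = f b"
    "(\<Sum>a<j. f a * (if b = a then 1 else 0)) = f b" if "b < j" for f :: "nat \<Rightarrow> 'k" and b
    using that by (simp_all add: if_distrib cong: if_cong)
  have "B (perp_proj j w y z) (w b) = 0 \<and> B (perp_proj j w y z) (y b) = 0" if "b < j" for b
    using assms that delta[OF that]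
    unfolding perp_proj_def hyperbolic_family_def
    by (simp add: B_add_left B_sum_left B_scale_left B_sym[of "y _" "w b"])
  then show ?thesis unfolding perp_def by blast
qed

lemma B_perp_proj:
  assumes "u \<in> perp j w y"
  shows "B u (perp_proj j w y z) = B u z"
proof -
  have "B (perp_proj j w y z) u = B z u"
    using assms unfolding perp_proj_def perp_def
    by (simp add: B_add_left B_sum_left B_scale_left B_sym[of "w _" u] B_sym[of "y _" u])
  then show ?thesis by (simp add: B_sym[of u])
qed

text \<open>If \<open>perp_proj\<close> vanished identically, the \<open>2j\<close> vectors \<open>w a, y a\<close> would span the space.\<close>
lemma perp_proj_nonzero:
  assumes "2 * j < vec.dim (UNIV :: ('k ^ 'i) set)"
  shows "\<exists>z. perp_proj j w y z \<noteq> 0"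
proof (rule ccontr)
  assume "\<nexists>z. perp_proj j w y z \<noteq> 0"
  then have zero: "perp_proj j w y z = 0" for z by blast
  define S where "S = w ` {..<j} \<union> y ` {..<j}"
  have "z \<in> vec.span S" for z
  proof -
    have "z = (\<Sum>a<j. B z (y a) *s w a + B z (w a) *s y a)"
      using zero[of z] unfolding perp_proj_def by (simp add: add_eq_0_iff2)
    also have "\<dots> \<in> vec.span S"
      by (intro vec.span_sum vec.span_add vec.span_scale vec.span_base) (auto simp: S_def)
    finally show ?thesis .
  qed
  then have "vec.dim (UNIV :: ('k ^ 'i) set) \<le> card S"
    by (intro vec.dim_le_card) (auto simp: S_def)
  also have "card S \<le> 2 * j"
    unfolding S_def using card_Un_le[of "w ` {..<j}" "y ` {..<j}"]
      card_image_le[of "{..<j}" w] card_image_le[of "{..<j}" y] by simp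
  finally show False using assms by simp
qed

lemma perp_nondegenerate:
  assumes "hyperbolic_family j w y" "u \<in> perp j w y" "u \<noteq> 0"
  shows "\<exists>v\<in>perp j w y. B u v \<noteq> 0"
proof -
  obtain z where "B u z \<noteq> 0" using B_nonzero_partner[OF assms(3)] by blast
  then show ?thesis
    using B_perp_proj[OF assms(2), of z] perp_proj_in_perp[OF assms(1), of z] by metis
qed

lemma perp_exists_unit_pair:
  assumes hyp: "hyperbolic_family j w y" and dim: "2 * j < vec.dim (UNIV :: ('k ^ 'i) set)"
  shows "\<exists>w'\<in>perp j w y. \<exists>y'\<in>perp j w y. q w' = 1 \<and> B w' y' = 1"
proof -
  obtain u where u: "u \<in> perp j w y" "u \<noteq> 0"
    using perp_proj_nonzero[OF dim] perp_proj_in_perp[OF hyp] by metis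
  then obtain v where v: "v \<in> perp j w y" "B u v \<noteq> 0"
    using perp_nondegenerate[OF hyp] by blast
  have "q u \<noteq> 0 \<or> q v \<noteq> 0 \<or> q (u + v) \<noteq> 0"
    using v(2) q_add[of u v] by auto
  then obtain a where a: "a \<in> perp j w y" "q a \<noteq> 0"
    using u(1) v(1) perp_add by blast
  then have "a \<noteq> 0" by auto
  then obtain b where b: "b \<in> perp j w y" "B a b \<noteq> 0"
    using perp_nondegenerate[OF hyp a(1)] by blast
  obtain r where r: "r ^ 2 = q a"
    using char2_square_surj[OF char2] by (metis surjD)
  then have "r \<noteq> 0" using a(2) by auto
  have "q ((1 / r) *s a) = 1"
    using r \<open>r \<noteq> 0\<close> a(2) by (simp add: q_scale power_divide)
  moreover have "B ((1 / r) *s a) ((r / B a b) *s b) = 1"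
    using \<open>r \<noteq> 0\<close> b(2) by (simp add: B_scale_left B_scale_right)
  ultimately show ?thesis
    using a(1) b(1) perp_scale by blast
qed

lemma exists_unit_hyperbolic_family:
  "2 * j \<le> vec.dim (UNIV :: ('k ^ 'i) set) \<Longrightarrow>
    \<exists>w y. hyperbolic_family j w y \<and> (\<forall>a<j. q (w a) = 1)"
proof (induction j)
  case 0
  then show ?case by (simp add: hyperbolic_family_def)
next
  case (Suc j)
  then obtain w y where hyp: "hyperbolic_family j w y" and unit: "\<forall>a<j. q (w a) = 1"
    by auto
  obtain w' y' where new: "w' \<in> perp j w y" "y' \<in> perp j w y" "q w' = 1" "B w' y' = 1"
    using perp_exists_unit_pair[OF hyp] Suc.prems by auto
  have "\<forall>a<j. B (w a) w' = 0 \<and> B (y a) w' = 0 \<and> B (w a) y' = 0 \<and> B (y a) y' = 0"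
    using new(1,2) unfolding perp_def by (simp add: B_sym[of "w _"] B_sym[of "y _"])
  then have "hyperbolic_family (Suc j) (w(j := w')) (y(j := y'))"
    using hyp new unfolding hyperbolic_family_def perp_def by (auto simp: less_Suc_eq)
  moreover have "\<forall>a<Suc j. q ((w(j := w')) a) = 1"
    using unit new by (auto simp: less_Suc_eq)
  ultimately show ?case by blast
qed

end

section \<open>Shears\<close>

locale orthonormal_quadruple = char2_quadratic_space q
  for q :: "'k::{field,finite} ^ 'i::finite \<Rightarrow> 'k" +
  fixes w y :: "nat \<Rightarrow> 'k ^ 'i"
  assumes hyperbolic: "hyperbolic_family 4 w y" and unit: "\<forall>a<4. q (w a) = 1"
begin

lemma B_w_w [simp]: "a < 4 \<Longrightarrow> b < 4 \<Longrightarrow> B (w a) (w b) = 0"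
  and B_w_y [simp]: "a < 4 \<Longrightarrow> b < 4 \<Longrightarrow> B (w a) (y b) = (if a = b then 1 else 0)"
  using hyperbolic unfolding hyperbolic_family_def by blast+

lemma B_y_w [simp]: "a < 4 \<Longrightarrow> b < 4 \<Longrightarrow> B (y b) (w a) = (if a = b then 1 else 0)"
  using B_w_y B_sym by metis

lemma q_w [simp]: "a < 4 \<Longrightarrow> q (w a) = 1"
  using unit by blast

abbreviation coord :: "nat \<Rightarrow> 'k ^ 'i \<Rightarrow> 'k" where
  "coord i z \<equiv> B z (w i)"

text \<open>\<open>shear M z = z + \<Sum>\<^sub>i\<^sub>,\<^sub>j M\<^sub>i\<^sub>j B(z, w\<^sub>i) w\<^sub>j\<close>. As the \<open>w\<^sub>j\<close> are mutually orthogonal, shears do not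
  change the coordinates \<open>B(-, w\<^sub>i)\<close>, so they compose by adding matrices.\<close>
definition shear_coeff :: "(nat \<Rightarrow> nat \<Rightarrow> 'k) \<Rightarrow> nat \<Rightarrow> 'k ^ 'i \<Rightarrow> 'k" where
  "shear_coeff M j z = M 0 j * coord 0 z + M 1 j * coord 1 z + M 2 j * coord 2 z + M 3 j * coord 3 z"

definition shear :: "(nat \<Rightarrow> nat \<Rightarrow> 'k) \<Rightarrow> 'k ^ 'i \<Rightarrow> 'k ^ 'i" where
  "shear M z = z + shear_coeff M 0 z *s w 0 + shear_coeff M 1 z *s w 1
     + shear_coeff M 2 z *s w 2 + shear_coeff M 3 z *s w 3"

lemma coord_shear: "k < 4 \<Longrightarrow> coord k (shear M z) = coord k z"
  unfolding shear_def by (simp add: B_add_left B_scale_left)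

lemma shear_coeff_shear: "shear_coeff M j (shear N z) = shear_coeff M j z"
  unfolding shear_coeff_def by (simp add: coord_shear)

lemma shear_shear: "shear M (shear N z) = shear (\<lambda>i j. M i j + N i j) z"
  unfolding shear_def[of M] shear_coeff_shear unfolding shear_def shear_coeff_def
  by (simp add: algebra_simps)

lemma shear_zero: "shear (\<lambda>i j. 0) z = z"
  by (simp add: shear_def shear_coeff_def)

lemma shear_involutive: "shear M \<circ> shear M = id"
  by (simp add: fun_eq_iff shear_shear shear_zero)

lemma shear_add: "shear M (a + b) = shear M a + shear M b"
  unfolding shear_def shear_coeff_def by (simp add: B_add_left algebra_simps)

lemma shear_scale: "shear M (c *s a) = c *s shear M a"
  unfolding shear_def shear_coeff_def
  by (simp add: B_scale_left algebra_simps)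

lemma linear_shear: "Vector_Spaces.linear (*s) (*s) (shear M)"
  by (simp add: Vector_Spaces.linear_iff vec.vector_space_axioms shear_add shear_scale)

lemma bij_shear: "bij (shear M)"
  using shear_involutive by (metis o_bij)

lemma q_add_w:
  "q (z + a *s w 0 + b *s w 1 + c *s w 2 + d *s w 3)
   = q z + a ^ 2 + b ^ 2 + c ^ 2 + d ^ 2 + a * coord 0 z + b * coord 1 z + c * coord 2 z + d * coord 3 z"
  by (simp add: q_add q_scale B_add_left B_add_right B_scale_left B_scale_right B_sym[of "w _" z]
      algebra_simps)

lemma q_shear: "q (shear M z) = q z
    + shear_coeff M 0 z ^ 2 + shear_coeff M 1 z ^ 2 + shear_coeff M 2 z ^ 2 + shear_coeff M 3 z ^ 2
    + shear_coeff M 0 z * coord 0 z + shear_coeff M 1 z * coord 1 z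
    + shear_coeff M 2 z * coord 2 z + shear_coeff M 3 z * coord 3 z"
  unfolding shear_def by (rule q_add_w)

lemma shear_diff: "shear M v - v = shear_coeff M 0 v *s w 0 + shear_coeff M 1 v *s w 1
    + shear_coeff M 2 v *s w 2 + shear_coeff M 3 v *s w 3"
  unfolding shear_def by (simp del: vec_diff_eq_add add: add.assoc)

lemma subspace_range_shear_diff: "vec.subspace (range (\<lambda>v. shear M v - v))"
proof (rule vec.subspaceI)
  show "0 \<in> range (\<lambda>v. shear M v - v)"
    using shear_scale[of M 0 0] by (intro range_eqI[of _ _ 0]) simp
next
  fix a b assume "a \<in> range (\<lambda>v. shear M v - v)" "b \<in> range (\<lambda>v. shear M v - v)"
  then obtain u v where "a = shear M u - u" "b = shear M v - v" by blast
  then show "a + b \<in> range (\<lambda>v. shear M v - v)"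
    by (intro range_eqI[of _ _ "u + v"]) (simp add: shear_add algebra_simps)
next
  fix c a assume "a \<in> range (\<lambda>v. shear M v - v)"
  then obtain u where "a = shear M u - u" by blast
  then show "c *s a \<in> range (\<lambda>v. shear M v - v)"
    by (intro range_eqI[of _ _ "c *s u"]) (simp add: shear_scale vector_add_ldistrib)
qed

lemma w_inj: "a < 4 \<Longrightarrow> b < 4 \<Longrightarrow> w a = w b \<Longrightarrow> a = b"
  using B_w_y[of a a] B_w_y[of b a] by (metis one_neq_zero)

lemma independent_w:
  assumes "S \<subseteq> {..<4}" shows "vec.independent (w ` S)"
proof (rule vec.independent_if_scalars_zero)
  show "finite (w ` S)" using assms finite_subset by blast
next
  fix f x assume sum: "(\<Sum>x\<in>w ` S. f x *s x) = 0" and "x \<in> w ` S"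
  then obtain k where k: "k \<in> S" "x = w k" by blast
  have "(\<Sum>v\<in>w ` S. f v * B v (y k)) = (\<Sum>v\<in>w ` S. if v = w k then f v else 0)"
  proof (rule sum.cong)
    fix v assume "v \<in> w ` S"
    then obtain a where "a \<in> S" "v = w a" by blast
    moreover have "a < 4" "k < 4" using \<open>a \<in> S\<close> k(1) assms by auto
    ultimately show "f v * B v (y k) = (if v = w k then f v else 0)"
      using w_inj by auto
  qed simp
  then have "B (\<Sum>v\<in>w ` S. f v *s v) (y k) = f (w k)"
    using k by (simp add: B_sum_left B_scale_left)
  then show "f x = 0" using sum k by simp
qed

lemma card_image_w: "S \<subseteq> {..<4} \<Longrightarrow> card (w ` S) = card S"
  by (rule card_image) (meson inj_onI lessThan_iff subsetD w_inj)

lemma dickson_invariant_shear: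
  assumes S: "S \<subseteq> {..<4}" "even (card S)"
    and displacements: "\<And>v. shear M v - v \<in> vec.span (w ` S)"
    and attained: "\<And>k. k \<in> S \<Longrightarrow> \<exists>d. shear M d = d + w k"
  shows "dickson_invariant (shear M) = 0"
proof -
  have "w k \<in> range (\<lambda>v. shear M v - v)" if k: "k \<in> S" for k
  proof -
    obtain d where "shear M d = d + w k" using attained[OF k] by blast
    then have "w k = shear M d - d" by (simp del: vec_diff_eq_add)
    then show ?thesis by (rule range_eqI)
  qed
  then have "vec.span (w ` S) \<subseteq> range (\<lambda>v. shear M v - v)"
    using subspace_range_shear_diff by (intro vec.span_minimal) auto
  then have "range (\<lambda>v. shear M v - v) = vec.span (w ` S)"
    using displacements by blast
  then show ?thesis
    unfolding dickson_invariant_def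
    using vec.dim_span_eq_card_independent[OF independent_w[OF S(1)]] card_image_w[OF S(1)] S(2)
    by simp
qed

lemma shear_in_Omega_group:
  assumes "\<And>z. q (shear M z) = q z" and "dickson_invariant (shear M) = 0"
  shows "shear M \<in> Omega_group q"
  unfolding Omega_group_def O_group_def Sp_group_def
  using linear_shear bij_shear assms B_eq_if_preserves_q[of "shear M"] shear_add by auto

definition dual_vec :: "'k \<Rightarrow> 'k \<Rightarrow> 'k \<Rightarrow> 'k \<Rightarrow> 'k ^ 'i" where
  "dual_vec a b c d = a *s y 0 + b *s y 1 + c *s y 2 + d *s y 3"

lemma coord_dual_vec [simp]:
  "coord 0 (dual_vec a b c d) = a" "coord 1 (dual_vec a b c d) = b"
  "coord 2 (dual_vec a b c d) = c" "coord 3 (dual_vec a b c d) = d"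
  unfolding dual_vec_def by (simp_all add: B_add_left B_scale_left)

lemma span_w_combination:
  "a *s w 0 + b *s w 1 + c *s w 2 + d *s w 3 \<in> vec.span (w ` {0, 1, 2, 3})"
  by (intro vec.span_add vec.span_scale vec.span_base) auto

text \<open>Symmetric \<open>0/1\<close> matrices with even off-diagonal row sums: for these the shear preserves \<open>q\<close>.\<close>
definition MX :: "nat \<Rightarrow> nat \<Rightarrow> 'k" where
  "MX i j = (if i = j \<and> i < 2 then 1 else 0)"

definition MY :: "nat \<Rightarrow> nat \<Rightarrow> 'k" where
  "MY i j = (if (i, j) \<in> {(0,0), (1,0), (3,0), (0,1), (3,1), (2,2), (0,3), (1,3)} then 1 else 0)"

definition MXY :: "nat \<Rightarrow> nat \<Rightarrow> 'k" where
  "MXY i j = MX i j + MY i j"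

lemma shear_coeff_MX:
  "shear_coeff MX 0 z = coord 0 z" "shear_coeff MX 1 z = coord 1 z"
  "shear_coeff MX 2 z = 0" "shear_coeff MX 3 z = 0"
  by (simp_all add: shear_coeff_def MX_def)

lemma shear_coeff_MY:
  "shear_coeff MY 0 z = coord 0 z + coord 1 z + coord 3 z" "shear_coeff MY 1 z = coord 0 z + coord 3 z"
  "shear_coeff MY 2 z = coord 2 z" "shear_coeff MY 3 z = coord 0 z + coord 1 z"
  by (simp_all add: shear_coeff_def MY_def)

lemma shear_coeff_MXY:
  "shear_coeff MXY 0 z = coord 1 z + coord 3 z" "shear_coeff MXY 1 z = coord 0 z + coord 1 z + coord 3 z"
  "shear_coeff MXY 2 z = coord 2 z" "shear_coeff MXY 3 z = coord 0 z + coord 1 z"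
  by (simp_all add: shear_coeff_def MXY_def MX_def MY_def algebra_simps)

lemma q_shear_MX: "q (shear MX z) = q z"
  unfolding q_shear shear_coeff_MX by (simp add: power2_eq_square algebra_simps)

lemma shear_MX_moves:
  "shear MX (dual_vec 1 0 0 0) = dual_vec 1 0 0 0 + w 0"
  "shear MX (dual_vec 0 1 0 0) = dual_vec 0 1 0 0 + w 1"
  unfolding shear_def shear_coeff_MX by (simp_all del: One_nat_def)

lemma dickson_invariant_shear_MX: "dickson_invariant (shear MX) = 0"
proof (rule dickson_invariant_shear[of "{0, 1}"])
  show "shear MX v - v \<in> vec.span (w ` {0, 1})" for v
    unfolding shear_diff shear_coeff_MX
    by (simp del: One_nat_def) (intro vec.span_add vec.span_scale vec.span_base; auto)
  show "\<exists>d. shear MX d = d + w k" if "k \<in> {0, 1}" for k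
    using that shear_MX_moves by blast
qed auto

lemma q_shear_MY: "q (shear MY z) = q z"
  unfolding q_shear shear_coeff_MY by (simp add: power2_eq_square algebra_simps)

lemma shear_MY_moves:
  "shear MY (dual_vec 1 1 0 1) = dual_vec 1 1 0 1 + w 0"
  "shear MY (dual_vec 1 1 0 0) = dual_vec 1 1 0 0 + w 1"
  "shear MY (dual_vec 0 0 1 0) = dual_vec 0 0 1 0 + w 2"
  "shear MY (dual_vec 1 0 0 1) = dual_vec 1 0 0 1 + w 3"
  unfolding shear_def shear_coeff_MY by (simp_all del: One_nat_def)

lemma dickson_invariant_shear_MY: "dickson_invariant (shear MY) = 0"
proof (rule dickson_invariant_shear[of "{0, 1, 2, 3}"])
  show "shear MY v - v \<in> vec.span (w ` {0, 1, 2, 3})" for v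
    unfolding shear_diff by (rule span_w_combination)
  show "\<exists>d. shear MY d = d + w k" if "k \<in> {0, 1, 2, 3}" for k
    using that shear_MY_moves by blast
qed auto

lemma q_shear_MXY: "q (shear MXY z) = q z"
  unfolding q_shear shear_coeff_MXY by (simp add: power2_eq_square algebra_simps)

lemma shear_MXY_moves:
  "shear MXY (dual_vec 1 1 0 0) = dual_vec 1 1 0 0 + w 0"
  "shear MXY (dual_vec 1 1 0 1) = dual_vec 1 1 0 1 + w 1"
  "shear MXY (dual_vec 0 0 1 0) = dual_vec 0 0 1 0 + w 2"
  "shear MXY (dual_vec 0 1 0 1) = dual_vec 0 1 0 1 + w 3"
  unfolding shear_def shear_coeff_MXY by (simp_all del: One_nat_def)

lemma dickson_invariant_shear_MXY: "dickson_invariant (shear MXY) = 0"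
proof (rule dickson_invariant_shear[of "{0, 1, 2, 3}"])
  show "shear MXY v - v \<in> vec.span (w ` {0, 1, 2, 3})" for v
    unfolding shear_diff by (rule span_w_combination)
  show "\<exists>d. shear MXY d = d + w k" if "k \<in> {0, 1, 2, 3}" for k
    using that shear_MXY_moves by blast
qed auto

lemma shears_in_Omega_group:
  "shear MX \<in> Omega_group q" "shear MY \<in> Omega_group q" "shear MXY \<in> Omega_group q"
  using shear_in_Omega_group q_shear_MX q_shear_MY q_shear_MXY
    dickson_invariant_shear_MX dickson_invariant_shear_MY dickson_invariant_shear_MXY by auto

lemma shear_compose_MX_MY: "shear MX \<circ> shear MY = shear MXY"
  by (simp add: fun_eq_iff shear_shear MXY_def[abs_def])

theorem not_ext_splits_Omega_group:
  fixes \<alpha> :: "'k ^ 'i \<Rightarrow> 'k ^ 'i \<Rightarrow> complex"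
  assumes cocycle: "normalized_2cocycle \<alpha>" and omega: "\<forall>v w. \<alpha> v w / \<alpha> w v = omega_q q v w"
  shows "\<not> ext_splits q \<alpha> (Omega_group q)"
proof
  assume "ext_splits q \<alpha> (Omega_group q)"
  then obtain s where lifts: "\<forall>g\<in>Omega_group q. s g \<in> APs q \<alpha> \<and> lies_over (s g) g"
    and hom: "\<forall>g\<in>Omega_group q. \<forall>h\<in>Omega_group q. s (g \<circ> h) = s g \<circ> s h"
    unfolding ext_splits_def by blast
  obtain t :: 'k where trace: "abs_trace (t ^ 2) \<noteq> 0"
    using exists_abs_trace_nonzero[OF char2] char2_square_surj[OF char2] by (metis surjD)
  define p where "p = t *s w 0"
  have "q p = t ^ 2" unfolding p_def by (simp add: q_scale)
  have negates: "s (shear M) (tw_basis p) = cmult (-1) (tw_basis p)"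
    if "shear M \<in> Omega_group q" and "shear M d = d + w 0" for M d
  proof (rule involutive_lift_orthogonal_involution[OF cocycle omega])
    show "tw_algebra_aut \<alpha> (s (shear M))" "lies_over (s (shear M)) (shear M)"
      using lifts that(1) unfolding APs_def by blast+
    show "s (shear M) (s (shear M) f) = f" for f
      using ext_split_section_involutive[OF lifts hom id_in_Omega_group that(1) shear_involutive] .
    show "shear M \<in> O_group q" using that(1) unfolding Omega_group_def by blast
    show "shear M (t *s d) = t *s d + p"
      unfolding shear_scale that(2) p_def by (simp add: vector_add_ldistrib)
  qed (use shear_involutive trace \<open>q p = t ^ 2\<close> in auto)
  have "s (shear MXY) (tw_basis p) = s (shear MX) (s (shear MY) (tw_basis p))"
    using hom shears_in_Omega_group shear_compose_MX_MY by (metis comp_apply)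
  also have "\<dots> = tw_basis p"
    using negates[OF shears_in_Omega_group(1) shear_MX_moves(1)]
      negates[OF shears_in_Omega_group(2) shear_MY_moves(1)]
      tw_algebra_aut_cmult[of \<alpha> "s (shear MX)" "-1" "tw_basis p"] lifts shears_in_Omega_group(1)
    unfolding APs_def by simp
  finally have "tw_basis p = cmult (-1) (tw_basis p)"
    using negates[OF shears_in_Omega_group(3) shear_MXY_moves(1)] by simp
  then show False
    by (metis cmult_tw_basis_eq_iff mult_1 one_neq_neg_one)
qed

end

theorem proposition5p3:
  fixes q :: "'k::{field,finite} ^ 'i::finite \<Rightarrow> 'k"
    and \<alpha> :: "'k ^ 'i \<Rightarrow> 'k ^ 'i \<Rightarrow> complex"
    and n :: nat
  assumes "CHAR('k) = 2"
    and "vec.dim (UNIV :: ('k ^ 'i) set) = 2 * n" and "n \<ge> 4"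
    and "is_quadratic_form q" and "nondegenerate_polar q"
    and "normalized_2cocycle \<alpha>"
    and "\<forall>v w. \<alpha> v w / \<alpha> w v = omega_q q v w"
  shows "\<not> ext_splits q \<alpha> (Sp_group q) \<and> \<not> ext_splits q \<alpha> (O_group q)
       \<and> \<not> ext_splits q \<alpha> (Omega_group q)"
proof -
  interpret char2_quadratic_space q
    using assms(1,4,5) by unfold_locales
  obtain w y where "hyperbolic_family 4 w y" "\<forall>a<4. q (w a) = 1"
    using exists_unit_hyperbolic_family[of 4] assms(2,3) by auto
  then interpret orthonormal_quadruple q w y
    by unfold_locales
  have "\<not> ext_splits q \<alpha> (Omega_group q)"
    using not_ext_splits_Omega_group assms(6,7) .
  moreover have "Omega_group q \<subseteq> O_group q" "O_group q \<subseteq> Sp_group q"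
    unfolding Omega_group_def O_group_def by auto
  ultimately show ?thesis
    using ext_splits_mono by (metis order_trans)
qed

end
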